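(* Let $\mathrm{gap}=\mathrm{gap}(q)$ be the spectral gap of the East model on $\mathbb{Z}$ with parameter $p=1-q$. There exists a constant $C$, independent of $q$, such that for all $q\in(0,1/2)$ $$\mathrm{gap}<C\,q^{-2}\,q^{\log(1/q)/(2\log 2)}.$$
   Context: Let $\Omega=\{0,1\}^{\mathbb{Z}}$ and let $\mu=\bigotimes_{x\in\mathbb{Z}}\mu_x$ be the product measure with each $\mu_x$ Bernoulli($p$) on $\{0,1\}$ (value $1$ with probability $p$), $p=1-q$. The East model is the Markov process on $\Omega$ whose generator acts on local functions (functions depending on finitely many variables) by $$\mathcal{L}f(\omega)=\sum_{x\in\mathbb{Z}}(1-\omega_{x+1})\,[\mu_x(f)-f(\omega)],$$ where $\mu_x(f)=\int d\mu_x(\omega_x)f(\omega)$ averages over $\omega_x$ only, all other variables being held fixed. The operator $\mathcal{L}$ extends to a self-adjoint non-positive operator on $L^2(\Omega,\mu)$, and its spectral gap is the infimum of $\langle f,-\mathcal{L}f\rangle_{L^2(\mu)}/\mathrm{Var}_\mu(f)$ over non-constant $f$ in the domain. *)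

theory Defs
  imports "HOL-Probability.Probability"
begin

text \<open>
  Configurations are functions \<open>\<omega> :: int \<Rightarrow> bool\<close>, with \<open>True\<close> standing for the value 1 and \<open>False\<close>
  for the value 0; \<open>of_bool (\<omega> x)\<close> is the number \<open>\<omega>\<^sub>x\<close>. Everything is parametrised by \<open>q\<close>, with
  \<open>p = 1 - q\<close>.
\<close>

type_synonym config = "int \<Rightarrow> bool"

definition site_measure :: "real \<Rightarrow> bool measure" where
  "site_measure q = measure_pmf (bernoulli_pmf (1 - q))"

definition east_measure :: "real \<Rightarrow> config measure" where
  "east_measure q = (\<Pi>\<^sub>M x\<in>UNIV. site_measure q)"

definition local_fun :: "(config \<Rightarrow> real) \<Rightarrow> bool" where
  "local_fun f \<longleftrightarrow>
     (\<exists>A. finite A \<and> (\<forall>\<omega> \<eta>. (\<forall>x\<in>A. \<omega> x = \<eta> x) \<longrightarrow> f \<omega> = f \<eta>))"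

definition site_average :: "real \<Rightarrow> int \<Rightarrow> (config \<Rightarrow> real) \<Rightarrow> config \<Rightarrow> real" where
  "site_average q x f \<omega> = (\<integral>b. f (fun_upd \<omega> x b) \<partial>site_measure q)"

text \<open>
  For local \<open>f\<close> only finitely many summands are nonzero, so the infinite sum is a finite one.
  The value for non-local \<open>f\<close> is never used.
\<close>

definition east_local_gen :: "real \<Rightarrow> (config \<Rightarrow> real) \<Rightarrow> config \<Rightarrow> real" where
  "east_local_gen q f \<omega> =
     (\<Sum>\<^sub>\<infinity>x\<in>UNIV. (1 - of_bool (\<omega> (x + 1))) * (site_average q x f \<omega> - f \<omega>))"

definition L2 :: "'a measure \<Rightarrow> ('a \<Rightarrow> real) set" where
  "L2 M = {f \<in> borel_measurable M. integrable M (\<lambda>\<omega>. (f \<omega>)\<^sup>2)}"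

definition L2_inner :: "'a measure \<Rightarrow> ('a \<Rightarrow> real) \<Rightarrow> ('a \<Rightarrow> real) \<Rightarrow> real" where
  "L2_inner M f g = (\<integral>\<omega>. f \<omega> * g \<omega> \<partial>M)"

definition L2_tendsto :: "'a measure \<Rightarrow> (nat \<Rightarrow> 'a \<Rightarrow> real) \<Rightarrow> ('a \<Rightarrow> real) \<Rightarrow> bool" where
  "L2_tendsto M F f \<longleftrightarrow> (\<lambda>n. \<integral>\<omega>. (F n \<omega> - f \<omega>)\<^sup>2 \<partial>M) \<longlonglongrightarrow> 0"

text \<open>
  The graph of the self-adjoint generator on \<open>L\<^sup>2\<close>: the closure of the generator on local functions,
  which form a core. A pair \<open>(f, g)\<close> in the graph means that \<open>f\<close> is in the domain and that its image
  under the generator is \<open>g\<close>. Elements of \<open>L\<^sup>2\<close> are given by representatives, so \<open>g\<close> is determined by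
  \<open>f\<close> only up to almost everywhere equality.
\<close>

definition east_generator :: "real \<Rightarrow> ((config \<Rightarrow> real) \<times> (config \<Rightarrow> real)) set" where
  "east_generator q = {(f, g). f \<in> L2 (east_measure q) \<and> g \<in> L2 (east_measure q) \<and>
     (\<exists>F. (\<forall>n. local_fun (F n)) \<and>
          L2_tendsto (east_measure q) F f \<and>
          L2_tendsto (east_measure q) (\<lambda>n. east_local_gen q (F n)) g)}"

definition east_gap :: "real \<Rightarrow> real" where
  "east_gap q = Inf {L2_inner (east_measure q) f (\<lambda>\<omega>. - g \<omega>) /
                       prob_space.variance (east_measure q) f
                     | f g. (f, g) \<in> east_generator q \<and>
                            \<not> (\<exists>c. AE \<omega> in east_measure q. f \<omega> = c)}"

end

theory Submission
  imports Defs
begin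

text \<open>
  The test function is in the spirit of Aldous and Diaconis. Let \<open>L = 2 ^ k\<close> be of order \<open>1 / q\<close>, take the
  zeros in \<open>{0..<L}\<close> together with a frozen zero at \<open>L\<close>, and coalesce them deterministically: stage
  \<open>d\<close> removes every zero whose distance to the next zero on its right is exactly \<open>d\<close>. The test
  function indicates that the origin survives the first \<open>L - 1\<close> stages; its variance is of order
  \<open>q\<close>. A legal flip at \<open>x\<close> starts with a discrepancy in an interval of length 1, and every
  enlargement of that interval uses up one more zero and at most doubles its length. So the flip
  can affect the origin only if there is a chain of \<open>k\<close> further zeros, for which there are at most
  \<open>2 ^ (k * (k + 1) div 2)\<close> choices. The Rayleigh quotient is thus at most
  \<open>8 * 2 ^ k * 2 ^ (k * (k + 1) div 2) * q ^ k\<close>, which with \<open>k\<close> close to \<open>log 2 (1 / q)\<close> is the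
  claim.
\<close>

section \<open>Coalescing zeros\<close>

text \<open>Survivors of \<open>d\<close> stages lie more than \<open>d\<close> apart, so an
  occupied site at distance \<open>Suc d\<close> is automatically the next survivor; inspecting that
  one site is enough.\<close>

fun coalesce :: "nat \<Rightarrow> int set \<Rightarrow> int set" where
  "coalesce 0 Z = Z"
| "coalesce (Suc d) Z = {y \<in> coalesce d Z. y + int (Suc d) \<notin> coalesce d Z}"

lemma coalesce_subset: "coalesce d Z \<subseteq> Z"
  by (induction d) auto

lemma coalesce_gap:
  "y \<in> coalesce d Z \<Longrightarrow> z \<in> coalesce d Z \<Longrightarrow> y < z \<Longrightarrow> int d < z - y"
proof (induction d)
  case (Suc d)
  then have "int d < z - y" and "z \<noteq> y + int (Suc d)" by auto
  then show ?case by linarith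
qed simp

text \<open>
  In \<open>(u, r, W)\<close>, the interval \<open>{u..<r}\<close> is where a discrepancy started at \<open>x\<close> may have spread
  by means of the zeros in \<open>W\<close>; each zero is new and becomes one of the two end points.
\<close>

fun zero_chains :: "int \<Rightarrow> nat \<Rightarrow> (int \<times> int \<times> int set) set" where
  "zero_chains x 0 = {(x, x + 1, {})}"
| "zero_chains x (Suc j) = (\<Union>(u, r, W) \<in> zero_chains x j.
     (\<lambda>w. (w, r, insert w W)) ` {u - (r - u)..<u} \<union>
     (\<lambda>w. (u, w, insert w W)) ` {r<..r + (r - u)})"

lemma zero_chains_left:
  assumes "(u, r, W) \<in> zero_chains x j" "w < u" "u - w \<le> r - u"
  shows "(w, r, insert w W) \<in> zero_chains x (Suc j)"
  using assms by (auto intro!: bexI[of _ "(u, r, W)"])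

lemma zero_chains_right:
  assumes "(u, r, W) \<in> zero_chains x j" "r < w" "w - r \<le> r - u"
  shows "(u, w, insert w W) \<in> zero_chains x (Suc j)"
  using assms by (auto intro!: bexI[of _ "(u, r, W)"])

text \<open>Each extension at most doubles the interval, and its new end point lies outside the old
  one, so it differs from all earlier zeros. Avoiding \<open>x\<close> and \<open>x + 1\<close>
  keeps the chain zeros apart from the flipped site and from the zero that permits the flip.\<close>

lemma zero_chains_props:
  "(u, r, W) \<in> zero_chains x j \<Longrightarrow>
    u \<le> x \<and> x < r \<and> r - u \<le> 2 ^ j \<and> finite W \<and> card W = j \<and> W \<subseteq> {u..r} - {x, x + 1}"
proof (induction j arbitrary: u r W)
  case (Suc j)
  then consider
      u' W' where "(u', r, W') \<in> zero_chains x j" "u < u'" "u' - u \<le> r - u'" "W = insert u W'"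
    | r' W' where "(u, r', W') \<in> zero_chains x j" "r' < r" "r - r' \<le> r' - u" "W = insert r W'"
    by auto
  then show ?case
  proof cases
    case 1
    with Suc.IH[OF 1(1)] have "u \<notin> W'" by auto
    with 1 Suc.IH[OF 1(1)] show ?thesis by auto
  next
    case 2
    with Suc.IH[OF 2(1)] have "r \<notin> W'" by auto
    with 2 Suc.IH[OF 2(1)] show ?thesis by auto
  qed
qed simp

text \<open>A prefix of a chain is a chain. The union bound runs over chains of one fixed length,
  while the discrepancy argument yields a chain of unknown length.\<close>

lemma zero_chains_truncate:
  "(u, r, W) \<in> zero_chains x j \<Longrightarrow> k \<le> j \<Longrightarrow> \<exists>u' r' W'. (u', r', W') \<in> zero_chains x k \<and> W' \<subseteq> W"
proof (induction j arbitrary: u r W)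
  case (Suc j)
  show ?case
  proof (cases "k = Suc j")
    case False
    from Suc.prems(1) obtain u' r' W' where "(u', r', W') \<in> zero_chains x j" "W' \<subseteq> W"
      by auto
    with Suc.IH[of u' r' W'] Suc.prems(2) False show ?thesis
      by (meson le_SucE order_trans)
  qed (use Suc.prems in blast)
qed auto

lemma finite_zero_chains: "finite (zero_chains x j)"
  by (induction j) auto

text \<open>An interval of length at most \<open>2 ^ i\<close> has at most
  \<open>2 ^ (i + 1)\<close> extensions, left and right together; the exponents 1, ...,
  \<open>j\<close> add up to \<open>j * (j + 1) div 2\<close>.\<close>

lemma card_zero_chains_le: "card (zero_chains x j) \<le> 2 ^ (j * (j + 1) div 2)"
proof (induction j)
  case (Suc j)
  let ?ext = "\<lambda>(u, r, W). (\<lambda>w. (w, r, insert w W)) ` {u - (r - u)..<u} \<union>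
     (\<lambda>w. (u, w, insert w W)) ` {r<..r + (r - u)}"
  have ext: "card (?ext c) \<le> 2 ^ (j + 1)" if c: "c \<in> zero_chains x j" for c
  proof -
    obtain u r W where eq: "c = (u, r, W)" by (cases c) auto
    then have r: "u < r" "r - u \<le> 2 ^ j" using zero_chains_props[of u r W x j] c by auto
    then have n: "nat (r - u) \<le> 2 ^ j" by (simp add: nat_le_iff)
    have "card (?ext c) \<le> card {u - (r - u)..<u} + card {r<..r + (r - u)}"
      unfolding eq prod.case
      by (intro order.trans[OF card_Un_le] add_mono card_image_le) auto
    also have "\<dots> = nat (r - u) + nat (r - u)" by simp
    also have "\<dots> \<le> 2 ^ (j + 1)" using n add_mono[OF n n] by simp
    finally show ?thesis .
  qed
  have "card (zero_chains x (Suc j)) \<le> (\<Sum>c\<in>zero_chains x j. card (?ext c))"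
    unfolding zero_chains.simps by (rule card_UN_le[OF finite_zero_chains])
  also have "\<dots> \<le> card (zero_chains x j) * 2 ^ (j + 1)"
    using sum_bounded_above[OF ext] by (simp only: of_nat_id)
  also have "\<dots> \<le> 2 ^ (j * (j + 1) div 2) * 2 ^ (j + 1)"
    by (intro mult_right_mono Suc.IH) auto
  also have "\<dots> = 2 ^ (j * (j + 1) div 2 + (j + 1))" by (simp add: power_add)
  also have "j * (j + 1) div 2 + (j + 1) = Suc j * (Suc j + 1) div 2"
  proof -
    have "Suc j * (Suc j + 1) = j * (j + 1) + (j + 1) * 2" by simp
    then show ?thesis by simp
  qed
  finally show ?case .
qed simp

text \<open>Needed because the right end \<open>r\<close> may itself be removed at stage
  \<open>s\<close>. Walking right through \<open>A\<close> in steps of \<open>s\<close>, every step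
  is an admissible extension since the interval only grows; \<open>A\<close> is bounded above, so
  the walk stops at a point with no point of \<open>A\<close> at distance \<open>s\<close>.\<close>

lemma zero_chains_extend_right:
  assumes "(u, r, W) \<in> zero_chains x j" "W \<subseteq> Z" "r \<in> A" "A \<subseteq> Z" "A \<subseteq> {..L}" "0 < s" "s \<le> r - u"
  shows "\<exists>j' r' W'. (u, r', W') \<in> zero_chains x j' \<and> W' \<subseteq> Z \<and> r' \<in> A \<and> r' + s \<notin> A \<and> r \<le> r'"
  using assms
proof (induction "nat (L - r)" arbitrary: j r W rule: less_induct)
  case less
  show ?case
  proof (cases "r + s \<in> A")
    case True
    have "r + s \<le> L" using True less.prems by auto
    then have "\<exists>j' r' W'. (u, r', W') \<in> zero_chains x j' \<and> W' \<subseteq> Z \<and> r' \<in> A \<and> r' + s \<notin> A \<and> r + s \<le> r'"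
      using less.prems True
      by (intro less.hyps[of "r + s" "insert (r + s) W" "Suc j"] zero_chains_right) auto
    with less.prems(6) show ?thesis by (meson less_add_same_cancel1 less_imp_le order_trans)
  qed (use less.prems in blast)
qed

text \<open>
  The two coalescences differ at most inside \<open>{u..<r}\<close>, where \<open>r\<close> is a common survivor. While they
  differ, the stage number is at most \<open>r - u\<close>, so a zero that enlarges this interval lies at
  distance at most \<open>r - u\<close> from it.
\<close>

lemma coalesce_discrepancy:
  assumes x: "x \<notin> Z" "x + 1 \<in> Z" and Z: "Z \<subseteq> {..L}"
  shows "coalesce d Z = coalesce d (insert x Z) \<or>
    (\<exists>j u r W. (u, r, W) \<in> zero_chains x j \<and> W \<subseteq> Z \<and> r \<in> coalesce d Z \<and>
      (\<forall>y. y \<notin> {u..<r} \<longrightarrow> (y \<in> coalesce d Z \<longleftrightarrow> y \<in> coalesce d (insert x Z))))"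
proof (induction d)
  case 0
  show ?case using x by (intro disjI2 exI[of _ 0] exI[of _ x] exI[of _ "x + 1"] exI[of _ "{}"]) auto
next
  case (Suc d)
  let ?A = "coalesce d Z" and ?B = "coalesce d (insert x Z)" and ?s = "int (Suc d)"
  show ?case
  proof (cases "?A = ?B")
    case False
    with Suc obtain j u r W where c: "(u, r, W) \<in> zero_chains x j" "W \<subseteq> Z" "r \<in> ?A"
      and agree: "\<And>y. y \<notin> {u..<r} \<Longrightarrow> y \<in> ?A \<longleftrightarrow> y \<in> ?B"
      by blast
    have rB: "r \<in> ?B" using agree[of r] c(3) by auto
    obtain y where "y \<in> ?A \<union> ?B" and y: "u \<le> y" "y < r"
      using False agree by (metis UnCI atLeastLessThan_iff subsetI subset_antisym)
    \<comment> \<open>\<open>y\<close> and \<open>r\<close> survive together in one of the two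
      coalescences, so they are more than \<open>d\<close> apart. This is what keeps the stage
      number at most the interval length.\<close>
    then have s: "?s \<le> r - u"
      using coalesce_gap[of y d _ r] c(3) rB by fastforce
    obtain j' r' W' where c': "(u, r', W') \<in> zero_chains x j'" "W' \<subseteq> Z" "r' \<in> ?A" "r' + ?s \<notin> ?A" "r \<le> r'"
      using zero_chains_extend_right[OF c coalesce_subset order.trans[OF coalesce_subset Z] _ s] by auto
    have r': "r' \<in> coalesce (Suc d) Z" using c' by simp
    \<comment> \<open>A point left of the interval can become a discrepancy only if the site at
      distance \<open>?s\<close> to its right is itself a discrepancy, hence in the
      interval.\<close>
    let ?bad = "\<lambda>z. z < u \<and> (z \<in> coalesce (Suc d) Z \<longleftrightarrow> z \<notin> coalesce (Suc d) (insert x Z))"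
    have step: "z \<in> coalesce (Suc d) X \<longleftrightarrow> z \<in> coalesce d X \<and> z + ?s \<notin> coalesce d X" for z X
      by simp
    have bad: "z \<in> ?A \<and> z \<in> ?B \<and> u \<le> z + ?s" if "?bad z" for z
      using that agree[of z] agree[of "z + ?s"] unfolding step atLeastLessThan_iff by linarith
    have right: "z \<in> coalesce (Suc d) Z \<longleftrightarrow> z \<in> coalesce (Suc d) (insert x Z)" if "r' \<le> z" for z
      using that c'(5) agree[of z] agree[of "z + ?s"] unfolding step atLeastLessThan_iff by linarith
    show ?thesis
    proof (cases "\<exists>z. ?bad z")
      case True
      then obtain z where z: "?bad z" by blast
      \<comment> \<open>Bad points survive \<open>d\<close> stages and so lie more than
        \<open>d\<close> apart, yet all of them lie among the \<open>Suc d\<close> sites just left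
        of \<open>u\<close>. Hence a single left extension is enough.\<close>
      have uniq: "z' = z" if z': "?bad z'" for z'
      proof -
        have "\<not> z < z'" "\<not> z' < z"
          using bad[OF z] bad[OF z'] coalesce_gap[of z d Z z'] coalesce_gap[of z' d Z z] z z'
          by linarith+
        then show ?thesis by simp
      qed
      have "z \<in> Z" using bad[OF z] coalesce_subset by blast
      moreover have "(z, r', insert z W') \<in> zero_chains x (Suc j')"
        using bad[OF z] s c' z by (intro zero_chains_left) auto
      moreover have "y \<in> coalesce (Suc d) Z \<longleftrightarrow> y \<in> coalesce (Suc d) (insert x Z)"
        if "y \<notin> {z..<r'}" for y
      proof (cases "r' \<le> y")
        case False
        then have "y < z" using that by auto
        then show ?thesis using uniq[of y] z by linarith
      qed (use right in blast)
      ultimately show ?thesis using r' c'(2)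
        by (intro disjI2 exI[of _ "Suc j'"] exI[of _ z] exI[of _ r'] exI[of _ "insert z W'"]) blast
    next
      case False
      have "y \<in> coalesce (Suc d) Z \<longleftrightarrow> y \<in> coalesce (Suc d) (insert x Z)"
        if "y \<notin> {u..<r'}" for y
      proof (cases "r' \<le> y")
        case ge: False
        then have "y < u" using that by simp
        then show ?thesis using False by blast
      qed (use right in blast)
      then show ?thesis using r' c'(1,2) by blast
    qed
  qed simp
qed

text \<open>A discrepancy interval containing the origin has \<open>u \<le> 0 < r\<close>. The
  origin and \<open>r\<close> survive together in one of the two coalescences, so \<open>r\<close>
  is at least \<open>2 ^ k\<close>, and an interval of that length needs at least \<open>k\<close>
  extensions.\<close>

lemma coalesce_differ_imp_chain:
  assumes x: "x \<notin> Z" "x + 1 \<in> Z" and Z: "Z \<subseteq> {..2 ^ k}" and d: "int d + 1 = 2 ^ k"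
    and differ: "0 \<in> coalesce d Z \<longleftrightarrow> 0 \<notin> coalesce d (insert x Z)"
  shows "\<exists>(u, r, W) \<in> zero_chains x k. W \<subseteq> Z"
proof -
  have "coalesce d Z \<noteq> coalesce d (insert x Z)" using differ by metis
  with coalesce_discrepancy[OF x Z, of d] obtain j u r W
    where c: "(u, r, W) \<in> zero_chains x j" "W \<subseteq> Z" "r \<in> coalesce d Z"
      and agree: "\<And>y. y \<notin> {u..<r} \<Longrightarrow> y \<in> coalesce d Z \<longleftrightarrow> y \<in> coalesce d (insert x Z)"
    by blast
  have 0: "u \<le> 0" "0 < r" using agree[of 0] differ by auto
  have rB: "r \<in> coalesce d (insert x Z)" using agree[of r] c(3) by auto
  have "int d < r" using coalesce_gap[OF _ c(3) 0(2)] coalesce_gap[OF _ rB 0(2)] differ by auto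
  then have "(2::int) ^ k \<le> 2 ^ j" using d 0 zero_chains_props[OF c(1)] by linarith
  then have "k \<le> j" by simp
  from zero_chains_truncate[OF c(1) this] c(2) show ?thesis by (meson case_prodI order.trans)
qed

lemma coalesce_pair: "int d < L \<Longrightarrow> coalesce d {0, L} = {0, L}"
  by (induction d) auto

section \<open>Local functions and the Dirichlet form\<close>

lemma local_fun_coordinate: "local_fun (\<lambda>\<eta>. h (\<eta> x))"
  unfolding local_fun_def by (intro exI[of _ "{x}"]) auto

lemma local_fun_const: "local_fun (\<lambda>_. c)"
  unfolding local_fun_def by (intro exI[of _ "{}"]) auto

lemma local_fun_comp2:
  assumes "local_fun f" "local_fun g"
  shows "local_fun (\<lambda>\<eta>. h (f \<eta>) (g \<eta>))"
proof -
  obtain A B where "finite A" "finite B"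
    and f: "\<And>\<eta> \<xi>. (\<forall>x\<in>A. \<eta> x = \<xi> x) \<Longrightarrow> f \<eta> = f \<xi>"
    and g: "\<And>\<eta> \<xi>. (\<forall>x\<in>B. \<eta> x = \<xi> x) \<Longrightarrow> g \<eta> = g \<xi>"
    using assms unfolding local_fun_def by metis
  then show ?thesis unfolding local_fun_def
  proof (intro exI[of _ "A \<union> B"] conjI allI impI)
    fix \<eta> \<xi> :: config assume "\<forall>x\<in>A \<union> B. \<eta> x = \<xi> x"
    then have "f \<eta> = f \<xi>" "g \<eta> = g \<xi>" by (auto intro!: f g)
    then show "h (f \<eta>) (g \<eta>) = h (f \<xi>) (g \<xi>)" by simp
  qed auto
qed

lemma local_fun_upd:
  assumes "local_fun f" shows "local_fun (\<lambda>\<eta>. f (\<eta>(x := b)))"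
proof -
  obtain A where "finite A" and f: "\<And>\<eta> \<xi>. (\<forall>y\<in>A. \<eta> y = \<xi> y) \<Longrightarrow> f \<eta> = f \<xi>"
    using assms unfolding local_fun_def by metis
  then show ?thesis unfolding local_fun_def by (intro exI[of _ A]) (auto intro!: f)
qed

lemma local_fun_sum:
  assumes "finite A" "\<And>x. x \<in> A \<Longrightarrow> local_fun (f x)"
  shows "local_fun (\<lambda>\<eta>. \<Sum>x\<in>A. f x \<eta>)"
  using assms by (induction A) (auto intro: local_fun_const local_fun_comp2[where h = "(+)"])

lemma site_average_eq:
  assumes "0 \<le> q" "q \<le> 1"
  shows "site_average q x f \<eta> = (1 - q) * f (\<eta>(x := True)) + q * f (\<eta>(x := False))"
  using assms by (simp add: site_average_def site_measure_def algebra_simps)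

lemma local_fun_site_average:
  assumes "0 \<le> q" "q \<le> 1" "local_fun f"
  shows "local_fun (site_average q x f)"
proof -
  have "site_average q x f = (\<lambda>\<eta>. (1 - q) * f (\<eta>(x := True)) + q * f (\<eta>(x := False)))"
    using assms(1,2) by (intro ext site_average_eq)
  then show ?thesis
    using local_fun_comp2[where h = "\<lambda>a b. (1 - q) * a + q * b", OF local_fun_upd local_fun_upd]
      assms(3) by simp
qed

section \<open>Integration of local functions under the product measure\<close>

lemma prob_space_site_measure: "prob_space (site_measure q)"
  by (simp add: site_measure_def prob_space_measure_pmf)

lemma prob_space_east_measure: "prob_space (east_measure q)"
  unfolding east_measure_def by (intro prob_space_PiM prob_space_site_measure)

lemma space_east_measure [simp]: "space (east_measure q) = UNIV"
  by (simp add: east_measure_def space_PiM site_measure_def)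

lemma measurable_coordinate [measurable]:
  "(\<lambda>\<eta>. \<eta> x) \<in> measurable (east_measure q) (count_space UNIV)"
proof -
  have "(\<lambda>\<eta>. \<eta> x) \<in> measurable (east_measure q) (site_measure q)"
    unfolding east_measure_def by (rule measurable_component_singleton) simp
  then show ?thesis
    by (subst measurable_cong_sets[OF refl, of _ "site_measure q"]) (auto simp: site_measure_def)
qed

text \<open>\<open>f\<close> factors through the set of ones in \<open>A\<close>, which takes
  finitely many values, each on a cylinder event.\<close>

lemma borel_measurable_local_fun:
  assumes "local_fun f" shows "f \<in> borel_measurable (east_measure q)"
proof -
  obtain A where A: "finite A" and f: "\<And>\<eta> \<xi>. (\<forall>y\<in>A. \<eta> y = \<xi> y) \<Longrightarrow> f \<eta> = f \<xi>"
    using assms unfolding local_fun_def by metis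
  let ?G = "\<lambda>\<eta> :: config. {x \<in> A. \<eta> x}"
  have "{\<eta>. {x \<in> A. \<eta> x} = S} \<in> sets (east_measure q)" if "S \<subseteq> A" for S
  proof -
    have "{\<eta>. {x \<in> A. \<eta> x} = S} = {\<eta> \<in> space (east_measure q). \<forall>x\<in>A. \<eta> x = (x \<in> S)}"
      using that by auto
    also have "\<dots> \<in> sets (east_measure q)"
      using A by (intro sets.sets_Collect_finite_All) measurable
    finally show ?thesis .
  qed
  then have "?G \<in> measurable (east_measure q) (count_space (Pow A))"
    using A by (subst measurable_count_space_eq2) (auto simp: vimage_def)
  then have "(\<lambda>\<eta>. (\<lambda>S. f (\<lambda>x. x \<in> S)) (?G \<eta>)) \<in> borel_measurable (east_measure q)"
    by (rule measurable_compose) simp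
  also have "(\<lambda>\<eta>. (\<lambda>S. f (\<lambda>x. x \<in> S)) (?G \<eta>)) = f"
    by (intro ext f) auto
  finally show ?thesis .
qed

lemma bounded_local_fun:
  assumes "local_fun f" shows "\<exists>B. \<forall>\<eta>. \<bar>f \<eta>\<bar> \<le> B"
proof -
  obtain A where A: "finite A" and f: "\<And>\<eta> \<xi>. (\<forall>y\<in>A. \<eta> y = \<xi> y) \<Longrightarrow> f \<eta> = f \<xi>"
    using assms unfolding local_fun_def by metis
  have "f \<eta> \<in> (\<lambda>S. f (\<lambda>x. x \<in> S)) ` Pow A" for \<eta>
    by (rule image_eqI[of _ _ "{x \<in> A. \<eta> x}"]) (auto intro!: f)
  then have "finite (range f)"
    using A by (meson finite_Pow_iff finite_imageI finite_subset image_subsetI)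
  then show ?thesis by (meson finite_imp_bounded bounded_real rangeI)
qed

lemma integrable_local_fun:
  assumes "local_fun f" shows "integrable (east_measure q) f"
proof -
  interpret prob_space "east_measure q" by (rule prob_space_east_measure)
  obtain B where "\<And>\<eta>. \<bar>f \<eta>\<bar> \<le> B" using bounded_local_fun[OF assms] by blast
  then show ?thesis
    by (intro integrable_const_bound[of _ B] borel_measurable_local_fun assms) auto
qed

lemma local_fun_in_L2: "local_fun f \<Longrightarrow> f \<in> L2 (east_measure q)"
  unfolding L2_def power2_eq_square
  by (auto intro: borel_measurable_local_fun integrable_local_fun local_fun_comp2[where h = "(*)"])

text \<open>Resampling the coordinate at \<open>x\<close> independently preserves the product
  measure; Fubini then separates the new value from the rest.\<close>

lemma integral_site_average:
  assumes "local_fun f"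
  shows "(\<integral>\<eta>. site_average q x f \<eta> \<partial>east_measure q) = (\<integral>\<eta>. f \<eta> \<partial>east_measure q)"
proof -
  let ?M = "east_measure q" and ?S = "site_measure q" and ?u = "\<lambda>(b, \<eta>). \<eta>(x := b)"
  interpret M: prob_space ?M by (rule prob_space_east_measure)
  interpret S: prob_space ?S by (rule prob_space_site_measure)
  interpret pair_prob_space ?S ?M ..
  have u [measurable]: "?u \<in> measurable (?S \<Otimes>\<^sub>M ?M) ?M"
  proof -
    have "(\<lambda>p. (snd p)(x := fst p)) \<in> measurable (?S \<Otimes>\<^sub>M ?M) (Pi\<^sub>M UNIV (\<lambda>_. ?S))"
      by (rule measurable_fun_upd[where J = UNIV]) (auto simp: east_measure_def)
    then show ?thesis by (simp add: case_prod_beta' east_measure_def)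
  qed
  have M: "distr (?S \<Otimes>\<^sub>M ?M) ?M ?u = ?M"
    using distr_pair_PiM_eq_PiM[of UNIV "\<lambda>_. ?S" x] prob_space_site_measure[of q]
    by (simp add: east_measure_def)
  note f [measurable] = borel_measurable_local_fun[OF assms, of q]
  obtain B where B: "\<And>\<eta>. \<bar>f \<eta>\<bar> \<le> B" using bounded_local_fun[OF assms] by blast
  have "(\<integral>\<eta>. f \<eta> \<partial>?M) = (\<integral>\<eta>. f \<eta> \<partial>distr (?S \<Otimes>\<^sub>M ?M) ?M ?u)" by (simp only: M)
  also have "\<dots> = (\<integral>(b, \<eta>). f (\<eta>(x := b)) \<partial>(?S \<Otimes>\<^sub>M ?M))"
    by (subst integral_distr) (auto simp: case_prod_beta')
  also have "\<dots> = (\<integral>\<eta>. site_average q x f \<eta> \<partial>?M)"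
    unfolding site_average_def
  proof (rule integral_snd[symmetric], rule P.integrable_const_bound[of _ B])
    have "(\<lambda>p. f (?u p)) \<in> borel_measurable (?S \<Otimes>\<^sub>M ?M)" by measurable
    then show "(\<lambda>(b, \<eta>). f (\<eta>(x := b))) \<in> borel_measurable (?S \<Otimes>\<^sub>M ?M)"
      by (simp add: case_prod_beta')
  qed (auto simp: B)
  finally show ?thesis ..
qed

lemma measure_cylinder:
  assumes A: "finite A" and q: "0 \<le> q" "q \<le> 1"
  shows "measure (east_measure q) {\<eta>. \<forall>x\<in>A. \<eta> x = c x} = (\<Prod>x\<in>A. if c x then 1 - q else q)"
proof -
  interpret product_prob_space "\<lambda>_ :: int. site_measure q" UNIV
    by (intro product_prob_spaceI prob_space_site_measure)
  have cyl: "{\<eta>. \<forall>x\<in>A. \<eta> x = c x} = prod_emb UNIV (\<lambda>_. site_measure q) A (\<Pi>\<^sub>E x\<in>A. {c x})"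
    by (intro set_eqI) (simp only: prod_emb_iff restrict_PiE_iff mem_Collect_eq singleton_iff, simp add: site_measure_def)
  have "measure (east_measure q) {\<eta>. \<forall>x\<in>A. \<eta> x = c x} = (\<Prod>x\<in>A. measure (site_measure q) {c x})"
    unfolding east_measure_def cyl using A by (intro measure_PiM_emb) (auto simp: site_measure_def)
  also have "\<dots> = (\<Prod>x\<in>A. if c x then 1 - q else q)"
    using q by (intro prod.cong) (auto simp: site_measure_def measure_pmf_single)
  finally show ?thesis .
qed

lemma integral_cylinder:
  assumes A: "finite A" and q: "0 \<le> q" "q \<le> 1"
  shows "(\<integral>\<eta>. of_bool (\<forall>x\<in>A. \<eta> x = c x) \<partial>east_measure q) = (\<Prod>x\<in>A. if c x then 1 - q else q)"
proof -
  have "(\<lambda>\<eta>. of_bool (\<forall>x\<in>A. \<eta> x = c x)) = (indicator {\<eta>. \<forall>x\<in>A. \<eta> x = c x} :: _ \<Rightarrow> real)"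
    by (auto simp: indicator_def fun_eq_iff)
  then show ?thesis using measure_cylinder[OF assms] by simp
qed

lemma local_fun_cylinder:
  assumes "finite A" shows "local_fun (\<lambda>\<eta>. of_bool (\<forall>x\<in>A. \<eta> x = c x))"
  using assms unfolding local_fun_def by (intro exI[of _ A]) auto

section \<open>The generator and its quadratic form on local functions\<close>

lemma east_local_gen_eq_sum:
  assumes A: "finite A" and f: "\<forall>\<eta> \<xi>. (\<forall>x\<in>A. \<eta> x = \<xi> x) \<longrightarrow> f \<eta> = f \<xi>"
    and q: "0 \<le> q" "q \<le> 1"
  shows "east_local_gen q f \<eta> =
    (\<Sum>x\<in>A. (1 - of_bool (\<eta> (x + 1))) * (site_average q x f \<eta> - f \<eta>))"
proof -
  let ?t = "\<lambda>x. (1 - of_bool (\<eta> (x + 1))) * (site_average q x f \<eta> - f \<eta>)"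
  have "?t x = 0" if "x \<notin> A" for x
  proof -
    have "f (\<eta>(x := b)) = f \<eta>" for b using that f by auto
    then show ?thesis using q by (simp add: site_average_eq algebra_simps)
  qed
  then have "(\<Sum>\<^sub>\<infinity>x\<in>UNIV. ?t x) = (\<Sum>\<^sub>\<infinity>x\<in>A. ?t x)" by (intro infsum_cong_neutral) auto
  then show ?thesis using A by (simp add: east_local_gen_def)
qed

lemma local_fun_east_local_gen:
  assumes "local_fun f" "0 \<le> q" "q \<le> 1" shows "local_fun (east_local_gen q f)"
proof -
  obtain A where A: "finite A" and f: "\<forall>\<eta> \<xi>. (\<forall>x\<in>A. \<eta> x = \<xi> x) \<longrightarrow> f \<eta> = f \<xi>"
    using assms unfolding local_fun_def by metis
  have "east_local_gen q f = (\<lambda>\<eta>. \<Sum>x\<in>A. (1 - of_bool (\<eta> (x + 1))) * (site_average q x f \<eta> - f \<eta>))"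
    by (intro ext east_local_gen_eq_sum A f assms)
  then show ?thesis using A assms
    by (auto intro!: local_fun_sum local_fun_comp2[where h = "\<lambda>a b. a * (b :: real)"]
        local_fun_comp2[where h = "\<lambda>a b. a - (b :: real)"] local_fun_coordinate local_fun_site_average)
qed

text \<open>Averaging over one site does not change an integral, so each summand may first be
  averaged over its own site \<open>x\<close>, which turns
  \<open>f * (f - site_average q x f)\<close> into the conditional variance at
  \<open>x\<close>.\<close>

lemma dirichlet_form:
  assumes A: "finite A" and f: "\<forall>\<eta> \<xi>. (\<forall>x\<in>A. \<eta> x = \<xi> x) \<longrightarrow> f \<eta> = f \<xi>"
    and q: "0 \<le> q" "q \<le> 1"
  shows "L2_inner (east_measure q) f (\<lambda>\<eta>. - east_local_gen q f \<eta>) =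
    (\<Sum>x\<in>A. \<integral>\<eta>. (1 - of_bool (\<eta> (x + 1))) *
      (q * (1 - q) * (f (\<eta>(x := True)) - f (\<eta>(x := False)))\<^sup>2) \<partial>east_measure q)"
proof -
  let ?h = "\<lambda>x \<eta>. (1 - of_bool (\<eta> (x + 1))) * (f \<eta> * (f \<eta> - site_average q x f \<eta>))"
  have lf: "local_fun f" unfolding local_fun_def using A f by blast
  have lh: "local_fun (?h x)" for x
    by (intro local_fun_comp2[where h = "\<lambda>a b. a * (b :: real)"] lf q
        local_fun_comp2[where h = "\<lambda>a b. a - (b :: real)"] local_fun_coordinate local_fun_site_average)
  \<comment> \<open>Neither the constraint at \<open>x + 1\<close> nor
    \<open>site_average q x f\<close> depends on the value at \<open>x\<close>, so what remains is
    the variance of a two-valued variable.\<close>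
  have avg: "site_average q x (?h x) \<eta> = (1 - of_bool (\<eta> (x + 1))) *
      (q * (1 - q) * (f (\<eta>(x := True)) - f (\<eta>(x := False)))\<^sup>2)" for x \<eta>
    using q by (simp add: site_average_eq) algebra
  have "f \<eta> * - east_local_gen q f \<eta> = (\<Sum>x\<in>A. ?h x \<eta>)" for \<eta>
    unfolding east_local_gen_eq_sum[OF A f q] sum_negf[symmetric] sum_distrib_left
    by (intro sum.cong) (auto simp: algebra_simps)
  then have "L2_inner (east_measure q) f (\<lambda>\<eta>. - east_local_gen q f \<eta>) =
      (\<Sum>x\<in>A. \<integral>\<eta>. ?h x \<eta> \<partial>east_measure q)"
    unfolding L2_inner_def by (simp add: integrable_local_fun[OF lh])
  also have "\<dots> = (\<Sum>x\<in>A. \<integral>\<eta>. site_average q x (?h x) \<eta> \<partial>east_measure q)"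
    by (simp add: integral_site_average[OF lh])
  finally show ?thesis by (simp only: avg)
qed

lemma dirichlet_form_nonneg:
  assumes "local_fun f" "0 \<le> q" "q \<le> 1"
  shows "0 \<le> L2_inner (east_measure q) f (\<lambda>\<eta>. - east_local_gen q f \<eta>)"
proof -
  obtain A where A: "finite A" and f: "\<forall>\<eta> \<xi>. (\<forall>x\<in>A. \<eta> x = \<xi> x) \<longrightarrow> f \<eta> = f \<xi>"
    using assms unfolding local_fun_def by metis
  show ?thesis unfolding dirichlet_form[OF A f assms(2,3)]
    using assms(2,3) by (intro sum_nonneg Bochner_Integration.integral_nonneg) auto
qed

section \<open>Continuity of the inner product under L2 convergence\<close>

lemma L2_integrable_mult:
  assumes "f \<in> L2 M" "g \<in> L2 M" shows "integrable M (\<lambda>\<eta>. f \<eta> * g \<eta>)"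
proof (rule Bochner_Integration.integrable_bound[where f = "\<lambda>\<eta>. (f \<eta>)\<^sup>2 + (g \<eta>)\<^sup>2"])
  show "AE \<eta> in M. norm (f \<eta> * g \<eta>) \<le> norm ((f \<eta>)\<^sup>2 + (g \<eta>)\<^sup>2)"
  proof (rule AE_I2)
    fix \<eta>
    have "2 * \<bar>f \<eta>\<bar> * \<bar>g \<eta>\<bar> \<le> (f \<eta>)\<^sup>2 + (g \<eta>)\<^sup>2"
      using sum_squares_bound[of "\<bar>f \<eta>\<bar>" "\<bar>g \<eta>\<bar>"] by simp
    moreover have "0 \<le> \<bar>f \<eta>\<bar> * \<bar>g \<eta>\<bar>" by simp
    ultimately show "norm (f \<eta> * g \<eta>) \<le> norm ((f \<eta>)\<^sup>2 + (g \<eta>)\<^sup>2)"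
      unfolding real_norm_def abs_mult by linarith
  qed
qed (use assms in \<open>auto simp: L2_def\<close>)

lemma L2_diff:
  assumes "f \<in> L2 M" "g \<in> L2 M" shows "(\<lambda>\<eta>. f \<eta> - g \<eta>) \<in> L2 M"
  using assms L2_integrable_mult[OF assms] by (auto simp: L2_def power2_diff mult.assoc)

lemma young_inequality_squares:
  fixes u v s :: real assumes "0 < s" shows "2 * \<bar>u * v\<bar> \<le> s * u\<^sup>2 + v\<^sup>2 / s"
proof -
  have "0 \<le> (s * \<bar>u\<bar> - \<bar>v\<bar>)\<^sup>2 / s" using assms by simp
  also have "(s * \<bar>u\<bar> - \<bar>v\<bar>)\<^sup>2 = s * (s * \<bar>u\<bar>\<^sup>2) + \<bar>v\<bar>\<^sup>2 - s * (2 * (\<bar>u\<bar> * \<bar>v\<bar>))"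
    unfolding power2_diff power_mult_distrib power2_eq_square[of s] by (simp only: ac_simps)
  also have "\<dots> / s = s * u\<^sup>2 + v\<^sup>2 / s - 2 * \<bar>u * v\<bar>"
    using assms by (simp add: add_divide_distrib diff_divide_distrib abs_mult)
  finally show ?thesis by simp
qed

text \<open>The difference is \<open>a * b + f * b + g * a\<close> with \<open>a = F - f\<close> and
  \<open>b = G - g\<close>; each product is bounded by Young's inequality. The weight
  \<open>t\<close> on the cross terms stays free so that it can shrink with the error.\<close>

lemma mult_perturbation_bound:
  fixes F G f g t :: real assumes "0 < t"
  shows "\<bar>F * G - f * g\<bar> \<le>
    (((F - f)\<^sup>2 + (G - g)\<^sup>2) + t * (f\<^sup>2 + g\<^sup>2) + ((F - f)\<^sup>2 + (G - g)\<^sup>2) / t) / 2"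
proof -
  define a b where "a = F - f" and "b = G - g"
  have "\<bar>F * G - f * g\<bar> = \<bar>a * b + f * b + g * a\<bar>"
    by (simp add: a_def b_def algebra_simps)
  also have "\<dots> \<le> \<bar>a * b\<bar> + \<bar>f * b\<bar> + \<bar>g * a\<bar>" by linarith
  finally have "\<bar>F * G - f * g\<bar> * 2 \<le> (a\<^sup>2 + b\<^sup>2) + (t * f\<^sup>2 + b\<^sup>2 / t) + (t * g\<^sup>2 + a\<^sup>2 / t)"
    using young_inequality_squares[of 1 a b] young_inequality_squares[OF assms, of f b]
      young_inequality_squares[OF assms, of g a] by simp
  also have "\<dots> = (a\<^sup>2 + b\<^sup>2) + t * (f\<^sup>2 + g\<^sup>2) + (a\<^sup>2 + b\<^sup>2) / t"
    by (simp only: distrib_left add_divide_distrib ac_simps)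
  finally show ?thesis unfolding a_def b_def by (simp only: le_divide_eq_numeral1)
qed

lemma L2_inner_tendsto:
  assumes f: "f \<in> L2 M" and g: "g \<in> L2 M" and F: "\<And>n. F n \<in> L2 M" and G: "\<And>n. G n \<in> L2 M"
    and Ff: "L2_tendsto M F f" and Gg: "L2_tendsto M G g"
  shows "(\<lambda>n. L2_inner M (F n) (G n)) \<longlonglongrightarrow> L2_inner M f g"
proof -
  define e where "e n = (\<integral>\<eta>. (F n \<eta> - f \<eta>)\<^sup>2 \<partial>M) + (\<integral>\<eta>. (G n \<eta> - g \<eta>)\<^sup>2 \<partial>M)" for n
  define N where "N = (\<integral>\<eta>. (f \<eta>)\<^sup>2 \<partial>M) + (\<integral>\<eta>. (g \<eta>)\<^sup>2 \<partial>M)"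
  \<comment> \<open>Slightly more than \<open>sqrt (e n)\<close>: positive even if
    \<open>e n = 0\<close>, convergent to 0, and large enough for
    \<open>e n / t n \<le> sqrt (e n)\<close>.\<close>
  define t where "t n = sqrt (e n) + 1 / real (Suc n)" for n
  have e: "e \<longlonglongrightarrow> 0" using tendsto_add[OF Ff[unfolded L2_tendsto_def] Gg[unfolded L2_tendsto_def]]
    by (simp add: e_def[abs_def])
  have "(\<lambda>n. 1 / real (Suc n)) \<longlonglongrightarrow> 0" using LIMSEQ_inverse_real_of_nat by (simp add: inverse_eq_divide)
  then have "t \<longlonglongrightarrow> sqrt 0 + 0"
    unfolding t_def by (intro tendsto_add tendsto_real_sqrt e)
  then have t: "t \<longlonglongrightarrow> 0" by simp
  have "\<bar>L2_inner M (F n) (G n) - L2_inner M f g\<bar> \<le> (e n + t n * N + sqrt (e n)) / 2" for n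
  proof -
    let ?a = "\<lambda>\<eta>. F n \<eta> - f \<eta>" and ?b = "\<lambda>\<eta>. G n \<eta> - g \<eta>"
    let ?R = "\<lambda>\<eta>. (((?a \<eta>)\<^sup>2 + (?b \<eta>)\<^sup>2) + t n * ((f \<eta>)\<^sup>2 + (g \<eta>)\<^sup>2) + ((?a \<eta>)\<^sup>2 + (?b \<eta>)\<^sup>2) / t n) / 2"
    have e0: "0 \<le> e n" by (simp add: e_def)
    then have t0: "0 < t n" by (simp add: t_def add_nonneg_pos)
    have int: "integrable M (\<lambda>\<eta>. (?a \<eta>)\<^sup>2)" "integrable M (\<lambda>\<eta>. (?b \<eta>)\<^sup>2)"
      "integrable M (\<lambda>\<eta>. (f \<eta>)\<^sup>2)" "integrable M (\<lambda>\<eta>. (g \<eta>)\<^sup>2)"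
      using L2_diff[OF F f] L2_diff[OF G g] f g by (auto simp: L2_def)
    have "\<bar>L2_inner M (F n) (G n) - L2_inner M f g\<bar> = \<bar>\<integral>\<eta>. F n \<eta> * G n \<eta> - f \<eta> * g \<eta> \<partial>M\<bar>"
      unfolding L2_inner_def
      by (simp add: L2_integrable_mult[OF F G] L2_integrable_mult[OF f g])
    also have "\<dots> \<le> (\<integral>\<eta>. \<bar>F n \<eta> * G n \<eta> - f \<eta> * g \<eta>\<bar> \<partial>M)" by (rule integral_abs_bound)
    also have "\<dots> \<le> (\<integral>\<eta>. ?R \<eta> \<partial>M)"
    proof (rule integral_mono)
      show "integrable M (\<lambda>\<eta>. \<bar>F n \<eta> * G n \<eta> - f \<eta> * g \<eta>\<bar>)"
        by (intro integrable_abs Bochner_Integration.integrable_diff L2_integrable_mult F G f g)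
      show "integrable M ?R"
        by (intro integrable_divide_zero impI Bochner_Integration.integrable_add
            integrable_mult_right int)
    qed (rule mult_perturbation_bound[OF t0])
    also have "\<dots> = (e n + t n * N + e n / t n) / 2" by (simp add: int e_def N_def)
    also have "e n / t n \<le> sqrt (e n)"
    proof -
      have "e n = sqrt (e n) * sqrt (e n)" using e0 by simp
      also have "\<dots> \<le> sqrt (e n) * t n" using e0 by (intro mult_left_mono) (auto simp: t_def)
      finally show ?thesis using t0 by (simp add: divide_le_eq)
    qed
    finally show ?thesis by simp
  qed
  then have bound: "\<forall>\<^sub>F n in sequentially.
      norm (L2_inner M (F n) (G n) - L2_inner M f g) \<le> (e n + t n * N + sqrt (e n)) / 2"
    by (intro always_eventually allI) (simp only: real_norm_def)
  have "(\<lambda>n. (e n + t n * N + sqrt (e n)) / 2) \<longlonglongrightarrow> (0 + 0 * N + sqrt 0) / 2"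
    by (intro tendsto_intros e t) simp
  then have "(\<lambda>n. (e n + t n * N + sqrt (e n)) / 2) \<longlonglongrightarrow> 0" by simp
  with bound have "(\<lambda>n. L2_inner M (F n) (G n) - L2_inner M f g) \<longlonglongrightarrow> 0"
    by (rule Lim_null_comparison)
  then show ?thesis by (rule LIM_zero_cancel)
qed

section \<open>Upper bounds on the gap from local test functions\<close>

text \<open>The sign of the quadratic form on local functions passes to the closure by continuity of
  the inner product.\<close>

lemma east_generator_nonpos:
  assumes "(f, g) \<in> east_generator q" "0 \<le> q" "q \<le> 1"
  shows "0 \<le> L2_inner (east_measure q) f (\<lambda>\<eta>. - g \<eta>)"
proof -
  let ?M = "east_measure q"
  from assms(1) obtain F where f: "f \<in> L2 ?M" and g: "g \<in> L2 ?M" and F: "\<And>n. local_fun (F n)"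
    and lim: "L2_tendsto ?M F f" "L2_tendsto ?M (\<lambda>n. east_local_gen q (F n)) g"
    by (auto simp: east_generator_def)
  have "(\<lambda>n. L2_inner ?M (F n) (east_local_gen q (F n))) \<longlonglongrightarrow> L2_inner ?M f g"
    by (intro L2_inner_tendsto f g lim local_fun_in_L2 F local_fun_east_local_gen assms)
  moreover have "L2_inner ?M (F n) (east_local_gen q (F n)) \<le> 0" for n
    using dirichlet_form_nonneg[OF F assms(2,3)] by (simp add: L2_inner_def)
  ultimately have "L2_inner ?M f g \<le> 0" by (intro LIMSEQ_le_const2) auto
  then show ?thesis by (simp add: L2_inner_def)
qed

text \<open>The constant sequence puts \<open>f\<close> in the domain, and positive variance rules
  out almost sure constancy. The sign of the quadratic form bounds the set of quotients from below,
  so that its \<open>Inf\<close> is a true lower bound.\<close>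

lemma east_gap_le:
  assumes f: "local_fun f" and q: "0 \<le> q" "q \<le> 1"
    and var: "0 < prob_space.variance (east_measure q) f"
  shows "east_gap q \<le> L2_inner (east_measure q) f (\<lambda>\<eta>. - east_local_gen q f \<eta>) /
    prob_space.variance (east_measure q) f"
  unfolding east_gap_def
proof (rule cInf_lower)
  let ?M = "east_measure q"
  interpret prob_space ?M by (rule prob_space_east_measure)
  have "(f, east_local_gen q f) \<in> east_generator q"
    unfolding east_generator_def L2_tendsto_def
    using local_fun_in_L2[of _ q] f local_fun_east_local_gen[OF f q]
    by (auto intro!: exI[of _ "\<lambda>_. f"])
  moreover have "\<not> (AE \<eta> in ?M. f \<eta> = c)" for c
  proof
    assume c: "AE \<eta> in ?M. f \<eta> = c"
    have m [measurable]: "f \<in> borel_measurable ?M" by (rule borel_measurable_local_fun[OF f])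
    have "expectation f = (\<integral>\<eta>. c \<partial>?M)" using c by (intro integral_cong_AE) auto
    then have "expectation f = c" using prob_space by simp
    then have "variance f = (\<integral>\<eta>. 0 \<partial>?M)" using c by (intro integral_cong_AE) auto
    with var show False by simp
  qed
  ultimately show "L2_inner ?M f (\<lambda>\<eta>. - east_local_gen q f \<eta>) / variance f \<in>
      {L2_inner ?M f (\<lambda>\<eta>. - g \<eta>) / variance f | f g.
        (f, g) \<in> east_generator q \<and> \<not> (\<exists>c. AE \<eta> in ?M. f \<eta> = c)}"
    by blast
  show "bdd_below {L2_inner ?M f (\<lambda>\<eta>. - g \<eta>) / variance f | f g.
        (f, g) \<in> east_generator q \<and> \<not> (\<exists>c. AE \<eta> in ?M. f \<eta> = c)}"
    by (intro bdd_belowI[of _ 0])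
      (auto intro!: divide_nonneg_nonneg east_generator_nonpos q Bochner_Integration.integral_nonneg)
qed

section \<open>The test function\<close>

text \<open>Counting \<open>2 ^ k\<close> as a zero whatever \<open>\<eta>\<close> is there keeps
  the set a function of the window alone, while a legal flip at the last window site still finds its
  right neighbour among the zeros.\<close>

definition window_zeros :: "nat \<Rightarrow> config \<Rightarrow> int set" where
  "window_zeros k \<eta> = insert (2 ^ k) {x \<in> {0..<2 ^ k}. \<not> \<eta> x}"

definition survival :: "nat \<Rightarrow> config \<Rightarrow> real" where
  "survival k \<eta> = of_bool (0 \<in> coalesce (2 ^ k - 1) (window_zeros k \<eta>))"

lemma survival_cong:
  "\<forall>\<eta> \<xi>. (\<forall>x\<in>{0..<2 ^ k}. \<eta> x = \<xi> x) \<longrightarrow> survival k \<eta> = survival k \<xi>"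
proof (intro allI impI)
  fix \<eta> \<xi> :: config assume "\<forall>x\<in>{0..<2 ^ k}. \<eta> x = \<xi> x"
  then have "window_zeros k \<eta> = window_zeros k \<xi>" unfolding window_zeros_def by auto
  then show "survival k \<eta> = survival k \<xi>" by (simp add: survival_def)
qed

lemma local_fun_survival: "local_fun (survival k)"
  unfolding local_fun_def using survival_cong by (intro exI[of _ "{0..<2 ^ k}"]) blast

text \<open>
  The zero at \<open>2 ^ k\<close> is removed because it is frozen, so that its presence costs no factor \<open>q\<close>.
\<close>

definition chain_zeros :: "nat \<Rightarrow> int \<Rightarrow> int \<times> int \<times> int set \<Rightarrow> int set" where
  "chain_zeros k x c = insert (x + 1) (snd (snd c)) - {2 ^ k}"

lemma chain_zeros_card:
  assumes "c \<in> zero_chains x k"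
  shows "finite (chain_zeros k x c)" "k \<le> card (chain_zeros k x c)"
proof -
  obtain u r W where c: "c = (u, r, W)" by (cases c) auto
  have W: "finite W" "card W = k" "x + 1 \<notin> W"
    using zero_chains_props[of u r W x k] assms c by auto
  then show "finite (chain_zeros k x c)" by (simp add: chain_zeros_def c)
  have "Suc k = card (insert (x + 1) W)" using W by simp
  also have "\<dots> \<le> Suc (card (insert (x + 1) W - {2 ^ k}))"
    by (simp only: card_Diff_singleton_if split: if_split) linarith
  finally show "k \<le> card (chain_zeros k x c)" by (simp add: chain_zeros_def c)
qed

lemma survival_flip:
  assumes x: "x \<in> {0..<2 ^ k}" and zero: "\<not> \<eta> (x + 1)"
    and flip: "survival k (\<eta>(x := True)) \<noteq> survival k (\<eta>(x := False))"
  shows "\<exists>c \<in> zero_chains x k. \<forall>y\<in>chain_zeros k x c. \<not> \<eta> y"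
proof -
  let ?Z = "window_zeros k (\<eta>(x := True))"
  have "insert x ?Z = window_zeros k (\<eta>(x := False))"
    using x by (auto simp: window_zeros_def)
  then have "0 \<in> coalesce (2 ^ k - 1) ?Z \<longleftrightarrow> 0 \<notin> coalesce (2 ^ k - 1) (insert x ?Z)"
    using flip by (auto simp: survival_def)
  moreover have xZ: "x \<notin> ?Z" using x by (auto simp: window_zeros_def)
  moreover have "x + 1 \<in> ?Z" using x zero by (auto simp: window_zeros_def)
  moreover have "?Z \<subseteq> {..2 ^ k}" by (auto simp: window_zeros_def)
  moreover have "int (2 ^ k - 1) + 1 = 2 ^ k" by (simp add: of_nat_diff)
  ultimately obtain u r W where c: "(u, r, W) \<in> zero_chains x k" and W: "W \<subseteq> ?Z"
    using coalesce_differ_imp_chain[of x ?Z k "2 ^ k - 1"] by blast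
  have "\<not> \<eta> y" if "y \<in> chain_zeros k x (u, r, W)" for y
    using that W xZ zero by (auto simp: chain_zeros_def window_zeros_def split: if_splits)
  with c show ?thesis by blast
qed

section \<open>Rayleigh quotient of the test function\<close>

text \<open>Union bound over the \<open>2 ^ k\<close> sites and the chains from each site. Each
  chain costs at most \<open>q ^ k\<close>, and the flip rate gives one more factor
  \<open>q\<close>.\<close>

lemma survival_dirichlet_le:
  assumes q: "0 \<le> q" "q \<le> 1"
  shows "L2_inner (east_measure q) (survival k) (\<lambda>\<eta>. - east_local_gen q (survival k) \<eta>)
    \<le> 2 ^ k * (2 ^ (k * (k + 1) div 2) * q ^ Suc k)"
proof -
  let ?I = "{0..<2 ^ k} :: int set"
  let ?t = "\<lambda>x \<eta>. (1 - of_bool (\<eta> (x + 1))) *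
      (q * (1 - q) * (survival k (\<eta>(x := True)) - survival k (\<eta>(x := False)))\<^sup>2)"
  have term_le: "(\<integral>\<eta>. ?t x \<eta> \<partial>east_measure q) \<le> 2 ^ (k * (k + 1) div 2) * q ^ Suc k"
    if x: "x \<in> ?I" for x
  proof -
    let ?b = "\<lambda>c \<eta>. q * of_bool (\<forall>y\<in>chain_zeros k x c. \<eta> y = False)"
    have local_b: "local_fun (?b c)" if "c \<in> zero_chains x k" for c
      using local_fun_comp2[where h = "\<lambda>a b. a * (b :: real)", OF local_fun_const
          local_fun_cylinder[OF chain_zeros_card(1)[OF that], where c = "\<lambda>_. False"]] .
    have b_nonneg: "0 \<le> ?b c \<eta>" for c and \<eta> :: config using q by simp
    have pointwise: "?t x \<eta> \<le> (\<Sum>c\<in>zero_chains x k. ?b c \<eta>)" for \<eta>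
    proof (cases "\<not> \<eta> (x + 1) \<and> survival k (\<eta>(x := True)) \<noteq> survival k (\<eta>(x := False))")
      case True
      then obtain c where c: "c \<in> zero_chains x k" "\<forall>y\<in>chain_zeros k x c. \<not> \<eta> y"
        using survival_flip[OF x] by blast
      have "(survival k (\<eta>(x := True)) - survival k (\<eta>(x := False)))\<^sup>2 \<le> 1"
        by (simp add: survival_def)
      then have "?t x \<eta> \<le> 1 * (q * 1 * 1)"
        using q by (intro mult_mono) auto
      also have "\<dots> = ?b c \<eta>" using c(2) by simp
      also have "\<dots> \<le> (\<Sum>c\<in>zero_chains x k. ?b c \<eta>)"
        using c(1) b_nonneg finite_zero_chains by (intro member_le_sum) auto
      finally show ?thesis .
    next
      case False
      then have "?t x \<eta> = 0" by auto
      also have "\<dots> \<le> (\<Sum>c\<in>zero_chains x k. ?b c \<eta>)" by (intro sum_nonneg b_nonneg)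
      finally show ?thesis .
    qed
    have local_t: "local_fun (?t x)"
      by (rule local_fun_comp2[where h = "\<lambda>a b. (1 - a) * b", OF local_fun_coordinate
          local_fun_comp2[where h = "\<lambda>a b. q * (1 - q) * (a - b)\<^sup>2", OF
            local_fun_upd[OF local_fun_survival] local_fun_upd[OF local_fun_survival]]])
    have "(\<integral>\<eta>. ?t x \<eta> \<partial>east_measure q) \<le> (\<integral>\<eta>. (\<Sum>c\<in>zero_chains x k. ?b c \<eta>) \<partial>east_measure q)"
      by (intro integral_mono integrable_local_fun local_t local_fun_sum finite_zero_chains local_b pointwise)
    also have "\<dots> = (\<Sum>c\<in>zero_chains x k. \<integral>\<eta>. ?b c \<eta> \<partial>east_measure q)"
      by (intro Bochner_Integration.integral_sum integrable_local_fun local_b)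
    also have "\<dots> \<le> (\<Sum>c\<in>zero_chains x k. q ^ Suc k)"
    proof (rule sum_mono)
      fix c assume c: "c \<in> zero_chains x k"
      have "(\<integral>\<eta>. ?b c \<eta> \<partial>east_measure q) = q * q ^ card (chain_zeros k x c)"
        unfolding integral_mult_right_zero integral_cylinder[OF chain_zeros_card(1)[OF c] q]
        by simp
      also have "\<dots> \<le> q * q ^ k"
        using q chain_zeros_card(2)[OF c] by (intro mult_left_mono power_decreasing)
      finally show "(\<integral>\<eta>. ?b c \<eta> \<partial>east_measure q) \<le> q ^ Suc k" by simp
    qed
    also have "\<dots> = real (card (zero_chains x k)) * q ^ Suc k" by (simp only: sum_constant)
    also have "\<dots> \<le> 2 ^ (k * (k + 1) div 2) * q ^ Suc k"
    proof (rule mult_right_mono)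
      have "real (card (zero_chains x k)) \<le> real (2 ^ (k * (k + 1) div 2))"
        by (simp only: of_nat_le_iff card_zero_chains_le)
      then show "real (card (zero_chains x k)) \<le> 2 ^ (k * (k + 1) div 2)" by simp
    qed (use q in simp)
    finally show ?thesis .
  qed
  have "L2_inner (east_measure q) (survival k) (\<lambda>\<eta>. - east_local_gen q (survival k) \<eta>) =
      (\<Sum>x\<in>?I. \<integral>\<eta>. ?t x \<eta> \<partial>east_measure q)"
    by (rule dirichlet_form[OF _ survival_cong q]) simp
  also have "\<dots> \<le> (\<Sum>x\<in>?I. 2 ^ (k * (k + 1) div 2) * q ^ Suc k)"
    by (intro sum_mono term_le)
  also have "\<dots> = real (card ?I) * (2 ^ (k * (k + 1) div 2) * q ^ Suc k)" by (simp only: sum_constant)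
  also have "real (card ?I) = 2 ^ k" by (simp add: nat_power_eq)
  finally show ?thesis .
qed

text \<open>Bernoulli's inequality with exponent \<open>2 ^ k\<close> could give only the bound 0;
  with half that exponent it gives 1/2, which is then squared.\<close>

lemma one_minus_power_ge_quarter:
  fixes q :: real
  assumes "0 < k" "0 \<le> q" "2 ^ k * q \<le> 1"
  shows "1 / 4 \<le> (1 - q) ^ 2 ^ k"
proof -
  obtain j where k: "k = Suc j" using assms(1) gr0_conv_Suc by blast
  have "q \<le> 2 ^ j * q" using assms(2) by (simp add: mult_le_cancel_right1)
  with assms(3) have "q \<le> 1" by (simp add: k)
  have "1 / 2 \<le> 1 + real (2 ^ j) * (- q)" using assms(3) by (simp add: k)
  also have "\<dots> \<le> (1 + - q) ^ 2 ^ j"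
    using \<open>q \<le> 1\<close> by (intro Bernoulli_inequality) simp
  finally have "(1 / 2)\<^sup>2 \<le> ((1 - q) ^ 2 ^ j)\<^sup>2" by (intro power_mono) auto
  also have "((1 - q) ^ 2 ^ j)\<^sup>2 = (1 - q) ^ 2 ^ k"
    by (simp only: k power_mult[symmetric] power_Suc mult.commute)
  finally show ?thesis by (simp add: power2_eq_square)
qed

text \<open>For an indicator with mean \<open>m\<close> the variance is \<open>m * (1 - m)\<close>.
  Here \<open>m \<ge> q / 4\<close>, from the event that the origin is the only zero in the window,
  and \<open>m \<le> q \<le> 1 / 2\<close>, since survival needs a zero at the origin.\<close>

lemma survival_variance_ge:
  assumes q: "0 \<le> q" "q \<le> 1 / 2" and k: "0 < k" "2 ^ k * q \<le> 1"
  shows "q / 8 \<le> prob_space.variance (east_measure q) (survival k)"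
proof -
  let ?M = "east_measure q"
  interpret prob_space ?M by (rule prob_space_east_measure)
  note int = integrable_local_fun[OF local_fun_survival, of q k]
  have sq: "(survival k \<eta>)\<^sup>2 = survival k \<eta>" for \<eta> by (simp add: survival_def)
  let ?I = "{0..<2 ^ k} :: int set"
  have "q / 4 \<le> expectation (survival k)"
  proof -
    have I: "?I = insert 0 {1..<2 ^ k}" by auto
    have "q / 4 \<le> q * (1 - q) ^ 2 ^ k"
      using mult_left_mono[OF one_minus_power_ge_quarter[OF k(1) q(1) k(2)] q(1)] by simp
    also have "\<dots> \<le> q * (1 - q) ^ (2 ^ k - 1)"
      using q by (intro mult_left_mono power_decreasing) auto
    also have "\<dots> = (\<Prod>x\<in>?I. if x \<noteq> 0 then 1 - q else q)"
    proof -
      have "(\<Prod>x\<in>?I. if x \<noteq> 0 then 1 - q else q) = q * (\<Prod>x\<in>{1..<2 ^ k :: int}. 1 - q)"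
        unfolding I by (subst prod.insert) (auto intro!: arg_cong2[of _ _ _ _ "(*)"] prod.cong)
      also have "\<dots> = q * (1 - q) ^ (2 ^ k - 1)" by (simp add: nat_diff_distrib nat_power_eq)
      finally show ?thesis ..
    qed
    also have "\<dots> = (\<integral>\<eta>. of_bool (\<forall>x\<in>?I. \<eta> x = (x \<noteq> 0)) \<partial>?M)"
      by (rule integral_cylinder[symmetric]) (use q in auto)
    also have "\<dots> \<le> expectation (survival k)"
    proof (intro integral_mono integrable_local_fun local_fun_cylinder local_fun_survival)
      fix \<eta> :: config
      show "of_bool (\<forall>x\<in>?I. \<eta> x = (x \<noteq> 0)) \<le> survival k \<eta>"
      proof (cases "\<forall>x\<in>?I. \<eta> x = (x \<noteq> 0)")
        case True
        then have "window_zeros k \<eta> = {0, 2 ^ k}" by (auto simp: window_zeros_def)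
        moreover have "int (2 ^ k - 1) < 2 ^ k" by (simp add: of_nat_diff)
        ultimately have "survival k \<eta> = 1" by (simp add: survival_def coalesce_pair)
        then show ?thesis by simp
      next
        case False
        then have "of_bool (\<forall>x\<in>?I. \<eta> x = (x \<noteq> 0)) = (0 :: real)"
          by (simp only: of_bool_eq_0_iff not_False_eq_True)
        then show ?thesis by (simp only: survival_def zero_less_eq_of_bool)
      qed
    qed simp
    finally show ?thesis .
  qed
  moreover have "1 / 2 \<le> 1 - expectation (survival k)"
  proof -
    have "expectation (survival k) \<le> (\<integral>\<eta>. of_bool (\<forall>x\<in>{0}. \<eta> x = False) \<partial>?M)"
    proof (intro integral_mono integrable_local_fun local_fun_cylinder local_fun_survival)
      fix \<eta> :: config
      have "\<not> \<eta> 0" if "0 \<in> coalesce (2 ^ k - 1) (window_zeros k \<eta>)"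
        using that coalesce_subset by (fastforce simp: window_zeros_def)
      then show "survival k \<eta> \<le> of_bool (\<forall>x\<in>{0}. \<eta> x = False)" by (simp add: survival_def)
    qed simp
    also have "\<dots> = q" using integral_cylinder[of "{0}" q "\<lambda>_. False"] q by simp
    finally show ?thesis using q by simp
  qed
  ultimately have "q / 4 * (1 / 2) \<le> expectation (survival k) * (1 - expectation (survival k))"
    using q by (intro mult_mono) auto
  also have "\<dots> = variance (survival k)"
    by (subst variance_eq) (simp_all only: sq int, simp add: power2_eq_square algebra_simps)
  finally show ?thesis by simp
qed

text \<open>With \<open>n = log 2 (1 / q)\<close> both sides are powers of 2, and only the exponents
  need comparing.\<close>

lemma chain_bound_numeric:
  fixes q :: real
  assumes q: "0 < q" and k: "2 ^ k \<le> 1 / q" "1 / q < 2 ^ Suc k"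
  shows "8 * (2 ^ k * 2 ^ (k * (k + 1) div 2) * q ^ k)
    < 16 * q powr (- 2) * q powr (ln (1 / q) / (2 * ln 2))"
proof -
  define n where "n = log 2 (1 / q)"
  have "q = 2 powr (- n)" using q by (simp add: n_def log_divide powr_minus)
  have n: "real k \<le> n" "n < real k + 1"
    using k q by (simp_all add: n_def le_log_iff log_less_iff powr_realpow powr_add)
  have "even (k * (k + 1))" by simp
  then have div: "real (k * (k + 1) div 2) = real k * (real k + 1) / 2"
    by (simp add: real_of_nat_div algebra_simps)
  have "8 * (2 ^ k * 2 ^ (k * (k + 1) div 2) * q ^ k) =
      2 powr (3 + (real k + real (k * (k + 1) div 2) - n * real k))"
    unfolding \<open>q = _\<close> by (simp add: powr_add powr_diff powr_realpow powr_minus powr_powr[symmetric]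
      power_inverse field_simps)
  also have "\<dots> < 2 powr (4 + 2 * n - n * (n / 2))"
  proof -
    \<comment> \<open>Completing the square, the left exponent is
      \<open>3 + 3 * k / 2 + (n - k)\<^sup>2 / 2 - n\<^sup>2 / 2\<close>, so the rounding of
      \<open>n\<close> to \<open>k\<close> costs at most 1/2.\<close>
    have "(n - k) * (n - k) \<le> 1 * 1" using n by (intro mult_mono) auto
    then have "3 + (real k + real (k * (k + 1) div 2) - n * real k) < 4 + 2 * n - n * (n / 2)"
      using n unfolding div by (simp add: field_simps)
    then show ?thesis by simp
  qed
  also have "\<dots> = 16 * q powr (- 2) * q powr (n / 2)"
  proof -
    have "(16 :: real) = 2 powr 4" by simp
    then show ?thesis unfolding \<open>q = _\<close>
      by (simp only: powr_powr powr_add[symmetric]) (simp add: algebra_simps)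
  qed
  also have "n / 2 = ln (1 / q) / (2 * ln 2)" by (simp add: n_def log_def)
  finally show ?thesis .
qed

theorem theorem5p1:
  "\<exists>C::real. \<forall>q::real. 0 < q \<and> q < 1 / 2 \<longrightarrow>
     east_gap q < C * q powr (- 2) * q powr (ln (1 / q) / (2 * ln 2))"
proof (intro exI[of _ 16] allI impI)
  fix q :: real assume q: "0 < q \<and> q < 1 / 2"
  \<comment> \<open>The largest window with \<open>2 ^ k * q \<le> 1\<close>, as the variance bound
    requires; maximality keeps \<open>k\<close> within 1 of \<open>log 2 (1 / q)\<close>.\<close>
  define k where "k = nat \<lfloor>log 2 (1 / q)\<rfloor>"
  \<comment> \<open>This is where \<open>q < 1 / 2\<close> enters: it makes \<open>k\<close>
    positive, as the variance bound demands.\<close>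
  have "1 < log 2 (1 / q)" using q by (simp add: less_log_iff field_simps)
  then have floor: "real k \<le> log 2 (1 / q)" "log 2 (1 / q) < real (Suc k)" and k0: "0 < k"
    unfolding k_def by linarith+
  have k: "2 ^ k \<le> 1 / q" "1 / q < 2 ^ Suc k"
    using floor q by (simp_all add: le_log_iff log_less_iff powr_realpow powr_add)
  let ?D = "L2_inner (east_measure q) (survival k) (\<lambda>\<eta>. - east_local_gen q (survival k) \<eta>)"
  let ?V = "prob_space.variance (east_measure q) (survival k)"
  have V: "q / 8 \<le> ?V" using q k k0 by (intro survival_variance_ge) (auto simp: field_simps)
  have "east_gap q \<le> ?D / ?V"
    using q V by (intro east_gap_le local_fun_survival) auto
  also have "\<dots> \<le> (2 ^ k * (2 ^ (k * (k + 1) div 2) * q ^ Suc k)) / (q / 8)"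
    using q V by (intro frac_le survival_dirichlet_le) auto
  \<comment> \<open>The factor \<open>q\<close> from the flip rate cancels the \<open>q\<close> in
    the variance.\<close>
  also have "\<dots> = 8 * (2 ^ k * 2 ^ (k * (k + 1) div 2) * q ^ k)" using q by simp
  also have "\<dots> < 16 * q powr (- 2) * q powr (ln (1 / q) / (2 * ln 2))"
    using q k by (intro chain_bound_numeric) auto
  finally show "east_gap q < 16 * q powr (- 2) * q powr (ln (1 / q) / (2 * ln 2))" .
qed

end
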